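(* Let $n>k\ge1$ be relatively prime integers, $E$ a complex elliptic curve, $\tau\in E$. With $X_{n/k}$, $\sigma'$ and $\mathcal{L}'_{n/k}$ as in the context, there is an isomorphism of graded algebras $$B(X_{n/k},\sigma',\mathcal{L}'_{n/k})\cong B(X_{n/k},(\sigma')^{-1},\mathcal{L}'_{n/k}).$$
   Context: **Continued fraction.** $E=\mathbb{C}/\Lambda$ with $\Lambda$ a lattice. There are unique $g\ge1$ and integers $n_1,\dots,n_g\ge2$ with $\frac nk=[n_1,\dots,n_g]:=n_1-\cfrac{1}{n_2-\cfrac{1}{\ddots-\frac1{n_g}}}$. Let $d(a_1,\dots,a_r)$ be the determinant of the $r\times r$ tridiagonal matrix with diagonal $a_1,\dots,a_r$ and all entries $-1$ just above and below the diagonal ($d$ of the empty sequence is $1$). Put $k_i=d(n_{i+1},\dots,n_g)$ and $l_i=d(n_{i-1},\dots,n_1)$ for $1\le i\le g$, and let $\sigma:E^g\to E^g$ be $\sigma(z_1,\dots,z_g)=(z_1+\tau_1,\dots,z_g+\tau_g)$, $\tau_i=(k_i+l_i-n)\tau$. **Sheaves and the characteristic variety.** $\mathcal{L}_{n/k}=\mathcal{O}_{E^g}(D_{n/k})$ with $D_{n/k}=\sum_{i=1}^g E^{i-1}\times D_i\times E^{g-i}+\sum_{j=1}^{g-1}\Delta_{j,j+1}$, $D_i=(n_i-2+\delta_{i,1}+\delta_{i,g})(0)$, $\Delta_{j,j+1}=\{z\in E^g:z_j=z_{j+1}\}$. It is ample, generated by its global sections, and $\dim H^0=n$. $\Phi_{n/k}:E^g\to\mathbb{P}^{n-1}=\mathbb{P}(H^0(E^g,\mathcal{L}_{n/k})^*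 )$ is the morphism given by the complete linear system, $X_{n/k}$ is its image, $\mathcal{L}'_{n/k}=\mathcal{O}_{\mathbb{P}^{n-1}}(1)|_{X_{n/k}}$, and $\sigma'$ is the unique automorphism of $X_{n/k}$ with $\Phi_{n/k}\circ\sigma=\sigma'\circ\Phi_{n/k}$. The map $E^g\to X_{n/k}$ is a quotient morphism for the finite group $\Sigma_{n/k}$ generated by those automorphisms $s_i$ with $n_i=2$, where $s_i$ replaces $z_i$ by $z_{i-1}-z_i+z_{i+1}$ and fixes the other coordinates ($z_0=z_{g+1}=0$). **Twisted homogeneous coordinate rings.** $B(X,\sigma,\mathcal{L})=\bigoplus_{i\ge0}H^0(X,\mathcal{L}_i)$, $\mathcal{L}_i=\mathcal{L}\otimes\sigma^*\mathcal{L}\otimes\cdots\otimes(\sigma^{i-1})^*\mathcal{L}$, with product of $x\in H^0(\mathcal{L}_i)$ and $y\in H^0(\mathcal{L}_j)$ the image of $x\otimes(\sigma^i)^*y$ in $H^0(X,\mathcal{L}_{i+j})$. *)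

theory Defs
  imports
    "Jordan_Normal_Form.Determinant"
    "HOL-Algebra.QuotRing"
    "HOL-Analysis.Infinite_Sum"
begin

section \<open>Continued fraction and translation vector\<close>

text \<open>The sequence $(n_1,\dots,n_g)$ is a list \<open>ns\<close>; all indices are shifted to start at $0$,
  so $n_i$ is \<open>ns ! (i - 1)\<close> and $g$ is \<open>length ns\<close>.\<close>

fun neg_cont_frac :: "nat list \<Rightarrow> rat" where
  "neg_cont_frac [a] = of_nat a"
| "neg_cont_frac (a # b # as) = of_nat a - 1 / neg_cont_frac (b # as)"

definition tridiag_mat :: "nat list \<Rightarrow> int mat" where
  "tridiag_mat as = mat (length as) (length as)
     (\<lambda>(i, j). if i = j then int (as ! i) else if i = Suc j \<or> j = Suc i then - 1 else 0)"

definition tridiag_det :: "nat list \<Rightarrow> int" where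
  "tridiag_det as = det (tridiag_mat as)"

definition trans_coeff :: "nat \<Rightarrow> nat list \<Rightarrow> nat \<Rightarrow> int" where
  "trans_coeff n ns i = tridiag_det (drop (Suc i) ns) + tridiag_det (rev (take i ns)) - int n"

text \<open>Points of $E^g = (\mathbb{C}/\Lambda)^g$ are given by representatives in $\mathbb{C}^g$
  (\<open>carrier_vec g\<close>), and $\tau \in E$ by a representative in $\mathbb{C}$.  So functions on $E^g$ are
  $\Lambda^g$-periodic functions on $\mathbb{C}^g$.\<close>

definition complex_lattice :: "complex set \<Rightarrow> bool" where
  "complex_lattice \<Lambda> \<longleftrightarrow>
     (\<exists>\<omega>1 \<omega>2. Im (\<omega>2 / \<omega>1) \<noteq> 0 \<and> \<Lambda> = {of_int a * \<omega>1 + of_int b * \<omega>2 | a b. True})"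

definition translation :: "nat \<Rightarrow> nat list \<Rightarrow> complex \<Rightarrow> complex vec \<Rightarrow> complex vec" where
  "translation n ns \<tau> z = z + vec (length ns) (\<lambda>i. of_int (trans_coeff n ns i) * \<tau>)"


section \<open>The line bundle on the power of the elliptic curve and its global sections\<close>

definition polydisc :: "nat \<Rightarrow> complex vec \<Rightarrow> real \<Rightarrow> complex vec set" where
  "polydisc g a r = {z \<in> carrier_vec g. \<forall>i<g. cmod (z $ i - a $ i) < r}"

text \<open>Holomorphic near \<open>a\<close>, i.e. given by a convergent power series in $g$ variables on some
  polydisc around \<open>a\<close>.\<close>

definition holomorphic_near :: "nat \<Rightarrow> complex vec \<Rightarrow> (complex vec \<Rightarrow> complex) \<Rightarrow> bool" where
  "holomorphic_near g a F \<longleftrightarrow>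
     (\<exists>r>0. \<exists>c :: nat vec \<Rightarrow> complex. \<forall>z\<in>polydisc g a r.
        ((\<lambda>\<alpha>. c \<alpha> * (\<Prod>i<g. (z $ i - a $ i) ^ (\<alpha> $ i))) has_sum F z) (carrier_vec g))"

definition div_mult :: "nat list \<Rightarrow> nat \<Rightarrow> nat" where
  "div_mult ns i = ns ! i - 2 + of_bool (i = 0) + of_bool (Suc i = length ns)"

text \<open>A local equation at \<open>a\<close> of the effective divisor $D_{n/k}$: the component through \<open>a\<close> of
  the preimage of $z_i = 0$ in $\mathbb{C}^g$ is $z_i = a_i$ (if $a_i \in \Lambda$), and that of
  $z_j = z_{j+1}$ is $z_j - z_{j+1} = a_j - a_{j+1}$ (if $a_j - a_{j+1} \in \Lambda$).\<close>

definition local_eqn :: "complex set \<Rightarrow> nat list \<Rightarrow> complex vec \<Rightarrow> complex vec \<Rightarrow> complex" where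
  "local_eqn \<Lambda> ns a z =
     (\<Prod>i<length ns. if a $ i \<in> \<Lambda> then (z $ i - a $ i) ^ div_mult ns i else 1) *
     (\<Prod>j<length ns - 1. if a $ j - a $ Suc j \<in> \<Lambda>
                        then (z $ j - z $ Suc j) - (a $ j - a $ Suc j) else 1)"

definition div_supp :: "complex set \<Rightarrow> nat list \<Rightarrow> complex vec set" where
  "div_supp \<Lambda> ns = {a \<in> carrier_vec (length ns). local_eqn \<Lambda> ns a a = 0}"

text \<open>\<open>F\<close> is the holomorphic extension, near \<open>a\<close>, of the function \<open>f\<close> times the local equation
  at \<open>a\<close>; it expresses the section \<open>f\<close> of $\mathcal{O}(D)$ in the local trivialization at \<open>a\<close>.\<close>

definition local_section ::
  "complex set \<Rightarrow> nat list \<Rightarrow> complex vec \<Rightarrow> (complex vec \<Rightarrow> complex) \<Rightarrow> (complex vec \<Rightarrow> complex) \<Rightarrow> bool"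
where
  "local_section \<Lambda> ns a f F \<longleftrightarrow>
     holomorphic_near (length ns) a F \<and>
     (\<exists>r>0. \<forall>z\<in>polydisc (length ns) a r - div_supp \<Lambda> ns. f z * local_eqn \<Lambda> ns a z = F z)"

text \<open>$H^0(E^g, \mathcal{O}(D_{n/k}))$, the meromorphic functions \<open>f\<close> on $E^g$ with
  $\mathrm{div}(f) + D_{n/k} \ge 0$.  Such a function is represented by its values off the support
  of the divisor, and is set to $0$ elsewhere to make the representation unique.\<close>

definition H0_E :: "complex set \<Rightarrow> nat list \<Rightarrow> (complex vec \<Rightarrow> complex) set" where
  "H0_E \<Lambda> ns = {f.
     (\<forall>z. z \<notin> carrier_vec (length ns) \<or> z \<in> div_supp \<Lambda> ns \<longrightarrow> f z = 0) \<and>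
     (\<forall>z\<in>carrier_vec (length ns). \<forall>l\<in>carrier_vec (length ns).
        (\<forall>i<length ns. l $ i \<in> \<Lambda>) \<longrightarrow> f (z + l) = f z) \<and>
     (\<forall>a\<in>carrier_vec (length ns). \<exists>F. local_section \<Lambda> ns a f F)}"

text \<open>Evaluation of sections at \<open>a\<close>, in the local trivialization, as an element of the dual space
  (functionals are $0$ outside \<open>H0_E\<close>).  The line it spans does not depend on the trivialization;
  it is the image of \<open>a\<close> under the morphism to $\mathbb{P}(H^0(E^g,\mathcal{L}_{n/k})^*)$, the space
  of lines through the origin.\<close>

type_synonym functional = "(complex vec \<Rightarrow> complex) \<Rightarrow> complex"

definition eval_section :: "complex set \<Rightarrow> nat list \<Rightarrow> complex vec \<Rightarrow> functional" where
  "eval_section \<Lambda> ns a f =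
     (if f \<in> H0_E \<Lambda> ns then (THE v. \<exists>F. local_section \<Lambda> ns a f F \<and> F a = v) else 0)"

definition Phi :: "complex set \<Rightarrow> nat list \<Rightarrow> complex vec \<Rightarrow> functional set" where
  "Phi \<Lambda> ns a = {\<lambda>f. c * eval_section \<Lambda> ns a f | c. True}"

definition char_variety :: "complex set \<Rightarrow> nat list \<Rightarrow> functional set set" where
  "char_variety \<Lambda> ns = Phi \<Lambda> ns ` carrier_vec (length ns)"


section \<open>Projective varieties\<close>

text \<open>The ambient vector space consists of functions \<open>'i \<Rightarrow> complex\<close>; the elements of the
  coordinate set \<open>I\<close> give its linear coordinates.  (For the dual of \<open>H0_E\<close> the coordinates are the
  elements of \<open>H0_E\<close>.)  A point of projective space is a line, and a variety \<open>X\<close> is a set of lines.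
  As $\mathbb{C}$ is infinite, polynomials may be treated as functions.\<close>

type_synonym 'i point = "('i \<Rightarrow> complex) set"

inductive homog_poly :: "'i set \<Rightarrow> nat \<Rightarrow> (('i \<Rightarrow> complex) \<Rightarrow> complex) \<Rightarrow> bool" for I where
  const: "homog_poly I 0 (\<lambda>_. c)"
| coord: "i \<in> I \<Longrightarrow> homog_poly I d P \<Longrightarrow> homog_poly I (Suc d) (\<lambda>v. v i * P v)"
| add: "homog_poly I d P \<Longrightarrow> homog_poly I d Q \<Longrightarrow> homog_poly I d (\<lambda>v. P v + Q v)"

definition zariski_open :: "'i set \<Rightarrow> 'i point set \<Rightarrow> 'i point set \<Rightarrow> bool" where
  "zariski_open I X U \<longleftrightarrow>
     (\<exists>S. (\<forall>P\<in>S. \<exists>d. homog_poly I d P) \<and> U = {p \<in> X. \<exists>P\<in>S. \<exists>v\<in>p. P v \<noteq> 0})"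

definition regular_on :: "'i set \<Rightarrow> 'i point set \<Rightarrow> 'i point set \<Rightarrow> ('i point \<Rightarrow> complex) \<Rightarrow> bool" where
  "regular_on I X U f \<longleftrightarrow>
     (\<forall>p\<in>U. \<exists>W d P Q. zariski_open I X W \<and> p \<in> W \<and> W \<subseteq> U \<and> homog_poly I d P \<and> homog_poly I d Q \<and>
        (\<forall>q\<in>W. \<forall>v\<in>q - {\<lambda>_. 0}. Q v \<noteq> 0 \<and> f q = P v / Q v))"

definition variety_morphism ::
  "'i set \<Rightarrow> 'i point set \<Rightarrow> 'i point set \<Rightarrow> ('i point \<Rightarrow> 'i point) \<Rightarrow> bool" where
  "variety_morphism I X Y \<phi> \<longleftrightarrow> \<phi> ` X \<subseteq> Y \<and>
     (\<forall>U. zariski_open I Y U \<longrightarrow> zariski_open I X {p \<in> X. \<phi> p \<in> U} \<and>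
        (\<forall>f. regular_on I Y U f \<longrightarrow> regular_on I X {p \<in> X. \<phi> p \<in> U} (\<lambda>p. f (\<phi> p))))"

definition variety_automorphism ::
  "'i set \<Rightarrow> 'i point set \<Rightarrow> ('i point \<Rightarrow> 'i point) \<Rightarrow> bool" where
  "variety_automorphism I X \<phi> \<longleftrightarrow>
     bij_betw \<phi> X X \<and> variety_morphism I X X \<phi> \<and> variety_morphism I X X (inv_into X \<phi>)"


section \<open>Line bundles and their sections\<close>

text \<open>A line bundle is encoded so that iterated tensor products have the same type as their factors.
  Its fibre at \<open>p\<close> is the space of multilinear forms on a product of finitely many lines; \<open>args L p\<close> is
  that product (as a set of lists) and \<open>arity L\<close> the number of factors.  For $\mathcal{O}(1)$ there is
  one factor, the line \<open>p\<close> itself; tensor products of fibres correspond to concatenation.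
  The algebraic structure is given by \<open>frames L U\<close>, the nowhere vanishing local sections over \<open>U\<close> used
  as local trivializations.  A regular section is locally a regular function times a frame.\<close>

type_synonym 'i sect = "'i point \<Rightarrow> ('i \<Rightarrow> complex) list \<Rightarrow> complex"

record 'i line_bundle =
  arity :: nat
  args :: "'i point \<Rightarrow> ('i \<Rightarrow> complex) list set"
  frames :: "'i point set \<Rightarrow> 'i sect set"

definition structure_sheaf :: "'i line_bundle" where
  "structure_sheaf = \<lparr>arity = 0, args = (\<lambda>p. {[]}), frames = (\<lambda>U. {\<lambda>p vs. 1})\<rparr>"

definition O1 :: "'i set \<Rightarrow> 'i line_bundle" where
  "O1 I = \<lparr>arity = 1, args = (\<lambda>p. {[v] | v. v \<in> p}),
     frames = (\<lambda>U. {\<lambda>p vs. l (hd vs) | l. homog_poly I 1 l \<and> (\<forall>p\<in>U. \<forall>v\<in>p - {\<lambda>_. 0}. l v \<noteq> 0)})\<rparr>"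

definition pullback_bundle :: "('i point \<Rightarrow> 'i point) \<Rightarrow> 'i line_bundle \<Rightarrow> 'i line_bundle" where
  "pullback_bundle \<phi> L = \<lparr>arity = arity L, args = (\<lambda>p. args L (\<phi> p)),
     frames = (\<lambda>U. {\<lambda>p vs. e (\<phi> p) vs | e. e \<in> frames L (\<phi> ` U)})\<rparr>"

definition pullback_section :: "('i point \<Rightarrow> 'i point) \<Rightarrow> 'i sect \<Rightarrow> 'i sect" where
  "pullback_section \<phi> s = (\<lambda>p. s (\<phi> p))"

text \<open>The tensor product of two forms, the first of which has arity \<open>m\<close>.\<close>

definition tensor_section :: "nat \<Rightarrow> 'i sect \<Rightarrow> 'i sect \<Rightarrow> 'i sect" where
  "tensor_section m s t = (\<lambda>p vs. s p (take m vs) * t p (drop m vs))"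

definition tensor_bundle :: "'i line_bundle \<Rightarrow> 'i line_bundle \<Rightarrow> 'i line_bundle" where
  "tensor_bundle L M = \<lparr>arity = arity L + arity M,
     args = (\<lambda>p. {vs @ ws | vs ws. vs \<in> args L p \<and> ws \<in> args M p}),
     frames = (\<lambda>U. {tensor_section (arity L) e e' | e e'. e \<in> frames L U \<and> e' \<in> frames M U})\<rparr>"

definition H0 :: "'i set \<Rightarrow> 'i point set \<Rightarrow> 'i line_bundle \<Rightarrow> 'i sect set" where
  "H0 I X L = {s.
     (\<forall>p vs. p \<notin> X \<or> vs \<notin> args L p \<longrightarrow> s p vs = 0) \<and>
     (\<forall>p\<in>X. \<exists>U f e. zariski_open I X U \<and> p \<in> U \<and> regular_on I X U f \<and> e \<in> frames L U \<and>
        (\<forall>q\<in>U. \<forall>vs\<in>args L q. s q vs = f q * e q vs))}"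


section \<open>Twisted homogeneous coordinate rings\<close>

text \<open>\<open>twist_bundle \<sigma> L i\<close> is
  $\mathcal{L}\otimes\sigma^*\mathcal{L}\otimes\cdots\otimes(\sigma^{i-1})^*\mathcal{L}$.  With the
  encoding above, $\mathcal{L}_i \otimes (\sigma^i)^*\mathcal{L}_j$ and $\mathcal{L}_{i+j}$ have the
  same fibres, so no identification is needed in the product.\<close>

primrec twist_bundle :: "('i point \<Rightarrow> 'i point) \<Rightarrow> 'i line_bundle \<Rightarrow> nat \<Rightarrow> 'i line_bundle" where
  "twist_bundle \<sigma> L 0 = structure_sheaf"
| "twist_bundle \<sigma> L (Suc i) = tensor_bundle (twist_bundle \<sigma> L i) (pullback_bundle (\<sigma> ^^ i) L)"

definition twist_mult ::
  "('i point \<Rightarrow> 'i point) \<Rightarrow> 'i line_bundle \<Rightarrow> nat \<Rightarrow> 'i sect \<Rightarrow> 'i sect \<Rightarrow> 'i sect" where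
  "twist_mult \<sigma> L i x y =
     tensor_section (arity (twist_bundle \<sigma> L i)) x (pullback_section (\<sigma> ^^ i) y)"

text \<open>$B(X,\sigma,\mathcal{L})$ as an algebra over $\mathbb{C}$.  An element of the direct sum is the
  finitely supported sequence of its homogeneous components.\<close>

definition twisted_ring ::
  "'i set \<Rightarrow> 'i point set \<Rightarrow> ('i point \<Rightarrow> 'i point) \<Rightarrow> 'i line_bundle \<Rightarrow> (complex, nat \<Rightarrow> 'i sect) module"
where
  "twisted_ring I X \<sigma> L =
    \<lparr>partial_object.carrier = {x. (\<forall>i. x i \<in> H0 I X (twist_bundle \<sigma> L i)) \<and> finite {i. x i \<noteq> (\<lambda>p vs. 0)}},
     monoid.mult = (\<lambda>x y m p vs. \<Sum>i\<le>m. twist_mult \<sigma> L i (x i) (y (m - i)) p vs),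
     monoid.one = (\<lambda>i p vs. if i = 0 \<and> p \<in> X \<and> vs = [] then 1 else 0),
     ring.zero = (\<lambda>i p vs. 0),
     ring.add = (\<lambda>x y i p vs. x i p vs + y i p vs),
     module.smult = (\<lambda>c x i p vs. c * x i p vs)\<rparr>"

definition homogeneous_part :: "('c, nat \<Rightarrow> 's, 'm) module_scheme \<Rightarrow> nat \<Rightarrow> (nat \<Rightarrow> 's) set" where
  "homogeneous_part A i = {x \<in> carrier A. \<forall>j. j \<noteq> i \<longrightarrow> x j = \<zero>\<^bsub>A\<^esub> j}"

definition graded_algebra_iso ::
  "(complex, nat \<Rightarrow> 's, 'm) module_scheme \<Rightarrow> (complex, nat \<Rightarrow> 't, 'k) module_scheme \<Rightarrow>
   ((nat \<Rightarrow> 's) \<Rightarrow> (nat \<Rightarrow> 't)) \<Rightarrow> bool" where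
  "graded_algebra_iso A B h \<longleftrightarrow> h \<in> ring_iso A B \<and>
     (\<forall>c. \<forall>x\<in>carrier A. h (c \<odot>\<^bsub>A\<^esub> x) = c \<odot>\<^bsub>B\<^esub> h x) \<and>
     (\<forall>i. h ` homogeneous_part A i = homogeneous_part B i)"

end

(* The map nu z = -z of E^g preserves the divisor D_{n/k}, so it acts linearly on the sections of
   L_{n/k} and descends to an automorphism nu' of X_{n/k} with nu'^* O(1) = O(1).  It conjugates every
   translation of E^g to its inverse, hence conjugates sigma' to its inverse, and pulling sections
   back along nu' is the isomorphism. *)
theory Submission
  imports Defs "HOL-Analysis.Continuum_Not_Denumerable"
begin

section \<open>Pullback along an involution of the coordinates\<close>

text \<open>The sections serve as the coordinates of the dual space, so nu' is induced by the linear
  map sending \<open>v\<close> to \<open>v \<circ> \<beta>\<close> with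
  \<open>\<beta> = reflect\<close>. A linear map moves the vectors of a line, not only the line, and
  so gives a concrete identification of nu'^* O(1) with O(1). It is compatible with all tensor
  products, and no scalar ambiguity enters the multiplication. This makes the algebra independent of
  the geometry: it is done for any involution of coordinates that preserves a set of lines. The
  analytic obstacle is that evaluation at \<open>a\<close> is a definite description. It can be
  computed only once all holomorphic extensions of \<open>f\<close> times the local equation are
  known to have the same value at \<open>a\<close>. Continuity along one real ray from
  \<open>a\<close> suffices, because the ray meets the divisor for only countably many parameters.
  Evaluations at \<open>a\<close> and \<open>- a\<close> then correspond up to a sign, which
  disappears in projective space.\<close>

locale coordinate_involution =
  fixes I :: "'i set" and X :: "'i point set" and \<beta> :: "'i \<Rightarrow> 'i"
  assumes invol: "\<beta> (\<beta> i) = i"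
    and coords: "i \<in> I \<Longrightarrow> \<beta> i \<in> I"
    and variety: "p \<in> X \<Longrightarrow> (\<lambda>v. v \<circ> \<beta>) ` p \<in> X"
begin

definition reindex :: "('i \<Rightarrow> complex) \<Rightarrow> 'i \<Rightarrow> complex" where
  "reindex v = v \<circ> \<beta>"

definition reindex_line :: "'i point \<Rightarrow> 'i point" where
  "reindex_line p = reindex ` p"

text \<open>Reindexing the vectors along with the point includes the identification of nu'^* O(1)
  with O(1), so the result is again a form on the lines over \<open>p\<close>.\<close>

definition pull :: "'i sect \<Rightarrow> 'i sect" where
  "pull s = (\<lambda>p vs. s (reindex_line p) (map reindex vs))"

definition pull_graded :: "(nat \<Rightarrow> 'i sect) \<Rightarrow> nat \<Rightarrow> 'i sect" where
  "pull_graded x = (\<lambda>i. pull (x i))"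

lemma reindex_reindex [simp]: "reindex (reindex v) = v"
  by (simp add: reindex_def fun_eq_iff invol)

lemma map_reindex_reindex [simp]: "map reindex (map reindex vs) = vs"
  by (simp add: comp_def)

lemma reindex_zero [simp]: "reindex (\<lambda>_. 0) = (\<lambda>_. 0)"
  by (simp add: reindex_def fun_eq_iff)

lemma reindex_eq_zero [simp]: "reindex v = (\<lambda>_. 0) \<longleftrightarrow> v = (\<lambda>_. 0)"
  by (metis reindex_reindex reindex_zero)

lemma reindex_line_reindex_line [simp]: "reindex_line (reindex_line p) = p"
  by (simp add: reindex_line_def image_image)

lemma mem_reindex_line [simp]: "v \<in> reindex_line p \<longleftrightarrow> reindex v \<in> p"
  by (metis imageE imageI reindex_line_def reindex_reindex)

lemma mem_image_reindex_line [simp]: "p \<in> reindex_line ` U \<longleftrightarrow> reindex_line p \<in> U"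
  by (metis imageE imageI reindex_line_reindex_line)

lemma reindex_line_variety [simp]: "reindex_line p \<in> X \<longleftrightarrow> p \<in> X"
proof -
  have "reindex_line q \<in> X" if "q \<in> X" for q
    using variety[OF that] by (simp add: reindex_line_def reindex_def[abs_def])
  from this[of p] this[of "reindex_line p"] show ?thesis
    by auto
qed

lemma pull_pull [simp]: "pull (pull s) = s"
  unfolding pull_def by (simp del: map_map)

lemma pull_zero [simp]: "pull (\<lambda>p vs. 0) = (\<lambda>p vs. 0)"
  by (simp add: pull_def)

lemma pull_eq_zero [simp]: "pull s = (\<lambda>p vs. 0) \<longleftrightarrow> s = (\<lambda>p vs. 0)"
  by (metis pull_pull pull_zero)

lemma pull_graded_pull_graded [simp]: "pull_graded (pull_graded x) = x"
  by (simp add: pull_graded_def)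

lemma homog_poly_reindex: "homog_poly I d P \<Longrightarrow> homog_poly I d (\<lambda>v. P (reindex v))"
proof (induction rule: homog_poly.induct)
  case (coord i d P)
  then show ?case
    using homog_poly.coord[OF coords[OF coord.hyps(1)] coord.IH] by (simp add: reindex_def)
qed (simp_all add: homog_poly.const homog_poly.add)

lemma zariski_open_reindex_line:
  assumes "zariski_open I X U"
  shows "zariski_open I X (reindex_line ` U)"
proof -
  obtain S where S: "\<forall>P\<in>S. \<exists>d. homog_poly I d P" "U = {p \<in> X. \<exists>P\<in>S. \<exists>v\<in>p. P v \<noteq> 0}"
    using assms unfolding zariski_open_def by blast
  let ?S = "(\<lambda>P v. P (reindex v)) ` S"
  have hom: "\<forall>P\<in>?S. \<exists>d. homog_poly I d P"
    using S(1) homog_poly_reindex by blast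
  have "p \<in> reindex_line ` U \<longleftrightarrow> p \<in> {p \<in> X. \<exists>P\<in>?S. \<exists>v\<in>p. P v \<noteq> 0}" for p
  proof -
    have "(\<exists>v\<in>reindex_line p. P v \<noteq> 0) \<longleftrightarrow> (\<exists>v\<in>p. P (reindex v) \<noteq> 0)" for P :: "('i \<Rightarrow> complex) \<Rightarrow> complex"
      by (metis mem_reindex_line reindex_reindex)
    then show ?thesis
      by (simp add: S(2))
  qed
  then have "reindex_line ` U = {p \<in> X. \<exists>P\<in>?S. \<exists>v\<in>p. P v \<noteq> 0}"
    by (rule Set.set_eqI)
  with hom show ?thesis
    unfolding zariski_open_def by (intro exI[of _ ?S] conjI)
qed

lemma regular_on_reindex_line:
  assumes "regular_on I X U f"
  shows "regular_on I X (reindex_line ` U) (\<lambda>p. f (reindex_line p))"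
  unfolding regular_on_def
proof
  fix p assume "p \<in> reindex_line ` U"
  then obtain W d P Q where W: "zariski_open I X W" "reindex_line p \<in> W" "W \<subseteq> U"
    and PQ: "homog_poly I d P" "homog_poly I d Q"
    and f: "\<forall>q\<in>W. \<forall>v\<in>q - {\<lambda>_. 0}. Q v \<noteq> 0 \<and> f q = P v / Q v"
    using assms unfolding regular_on_def by (metis mem_image_reindex_line)
  have "\<forall>q\<in>reindex_line ` W. \<forall>v\<in>q - {\<lambda>_. 0}. Q (reindex v) \<noteq> 0 \<and> f (reindex_line q) = P (reindex v) / Q (reindex v)"
  proof (intro ballI)
    fix q v assume "q \<in> reindex_line ` W" and v: "v \<in> q - {\<lambda>_. 0}"
    then have "reindex_line q \<in> W" "reindex v \<in> reindex_line q - {\<lambda>_. 0}"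
      by simp_all
    with f show "Q (reindex v) \<noteq> 0 \<and> f (reindex_line q) = P (reindex v) / Q (reindex v)"
      by blast
  qed
  moreover have "p \<in> reindex_line ` W" "reindex_line ` W \<subseteq> reindex_line ` U"
    using W by auto
  ultimately show "\<exists>W d P Q. zariski_open I X W \<and> p \<in> W \<and> W \<subseteq> reindex_line ` U \<and> homog_poly I d P \<and>
      homog_poly I d Q \<and> (\<forall>q\<in>W. \<forall>v\<in>q - {\<lambda>_. 0}. Q v \<noteq> 0 \<and> f (reindex_line q) = P v / Q v)"
    using zariski_open_reindex_line[OF W(1)] homog_poly_reindex[OF PQ(1)] homog_poly_reindex[OF PQ(2)] by blast
qed

end

section \<open>Fibres and frames of the iterated twists of O(1)\<close>

lemma arity_twist_O1: "arity (twist_bundle \<sigma> (O1 I) i) = i"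
  by (induction i) (simp_all add: structure_sheaf_def tensor_bundle_def pullback_bundle_def O1_def)

lemma args_twist_O1_Suc:
  "args (twist_bundle \<sigma> (O1 I) (Suc i)) p =
     {vs @ [w] | vs w. vs \<in> args (twist_bundle \<sigma> (O1 I) i) p \<and> w \<in> (\<sigma> ^^ i) p}"
  by (auto simp: tensor_bundle_def pullback_bundle_def O1_def)

lemma length_args_twist_O1: "vs \<in> args (twist_bundle \<sigma> (O1 I) i) p \<Longrightarrow> length vs = i"
proof (induction i arbitrary: vs)
  case 0
  then show ?case by (simp add: structure_sheaf_def)
next
  case (Suc i)
  then show ?case unfolding args_twist_O1_Suc by auto
qed

text \<open>A linear form does not refer to the base point, so pulling back along
  \<open>\<sigma> ^^ i\<close> only changes the lines on which it must not vanish. Its argument is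
  the last vector of the list.\<close>

lemma frames_twist_O1_Suc:
  "frames (twist_bundle \<sigma> (O1 I) (Suc i)) U =
     {tensor_section i e (\<lambda>p vs. l (hd vs)) | e l. e \<in> frames (twist_bundle \<sigma> (O1 I) i) U \<and>
        homog_poly I 1 l \<and> (\<forall>p\<in>(\<sigma> ^^ i) ` U. \<forall>v\<in>p - {\<lambda>_. 0}. l v \<noteq> 0)}"
proof -
  have image1: "{h e | e. e \<in> {f l | l. Q l}} = {h (f l) | l. Q l}"
    for h :: "'x \<Rightarrow> 'y" and f :: "'z \<Rightarrow> 'x" and Q
    by blast
  have image2: "{t e e' | e e'. e \<in> A \<and> e' \<in> {f l | l. Q l}} = {t e (f l) | e l. e \<in> A \<and> Q l}"
    for t :: "'w \<Rightarrow> 'x \<Rightarrow> 'y" and A and f :: "'z \<Rightarrow> 'x" and Q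
    by blast
  have pullback: "frames (pullback_bundle \<phi> (O1 I)) U =
      {\<lambda>p vs. l (hd vs) | l. homog_poly I 1 l \<and> (\<forall>p\<in>\<phi> ` U. \<forall>v\<in>p - {\<lambda>_. 0}. l v \<noteq> 0)}" for \<phi>
    unfolding pullback_bundle_def O1_def line_bundle.select_convs by (rule image1)
  show ?thesis
    unfolding twist_bundle.simps tensor_bundle_def line_bundle.select_convs arity_twist_O1 pullback
    by (rule image2)
qed

section \<open>Conjugate automorphisms have isomorphic twisted rings\<close>

locale conjugating_involution = coordinate_involution +
  fixes \<sigma> \<rho> :: "'a point \<Rightarrow> 'a point"
  assumes \<sigma>_X: "p \<in> X \<Longrightarrow> \<sigma> p \<in> X"
    and \<rho>_X: "p \<in> X \<Longrightarrow> \<rho> p \<in> X"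
    and conj: "p \<in> X \<Longrightarrow> reindex_line (\<rho> p) = \<sigma> (reindex_line p)"
begin

text \<open>Since nu' is its own inverse, the conjugation relation can be read backwards; each
  transport result from \<open>\<sigma>\<close> to \<open>\<rho>\<close> thus also holds from
  \<open>\<rho>\<close> to \<open>\<sigma>\<close>.\<close>

lemma conjugating_involution_sym: "conjugating_involution I X \<beta> \<rho> \<sigma>"
proof unfold_locales
  fix p assume "p \<in> X"
  then have "reindex_line (\<rho> (reindex_line p)) = \<sigma> p"
    using conj[of "reindex_line p"] by simp
  then show "reindex_line (\<sigma> p) = \<rho> (reindex_line p)"
    by (metis reindex_line_reindex_line)
qed (simp_all add: \<sigma>_X \<rho>_X)

lemma funpow_X: "p \<in> X \<Longrightarrow> (\<rho> ^^ i) p \<in> X"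
  by (induction i) (simp_all add: \<rho>_X)

lemma conj_funpow: "p \<in> X \<Longrightarrow> reindex_line ((\<rho> ^^ i) p) = (\<sigma> ^^ i) (reindex_line p)"
  by (induction i) (simp_all add: conj funpow_X)

text \<open>The vector at position \<open>j\<close> lies on the line \<open>(\<rho> ^^ j) p\<close>,
  which nu' carries to \<open>(\<sigma> ^^ j) (reindex_line p)\<close>.\<close>

lemma map_reindex_args:
  assumes "p \<in> X"
  shows "map reindex vs \<in> args (twist_bundle \<sigma> (O1 I) i) (reindex_line p) \<longleftrightarrow> vs \<in> args (twist_bundle \<rho> (O1 I) i) p"
proof (induction i arbitrary: vs)
  case 0
  then show ?case by (simp add: structure_sheaf_def)
next
  case (Suc i)
  show ?case
  proof (cases vs rule: rev_cases)
    case Nil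
    then show ?thesis unfolding args_twist_O1_Suc by simp
  next
    case (snoc ws w)
    then show ?thesis
      using Suc.IH[of ws] unfolding args_twist_O1_Suc
      by (simp flip: conj_funpow[OF assms])
  qed
qed

text \<open>The restriction to lists of the right length is needed because a frame of \<open>O1\<close> also has a
  (meaningless) value on the empty list.\<close>

lemma frames_reindex_line:
  assumes "U \<subseteq> X" and "e \<in> frames (twist_bundle \<sigma> (O1 I) i) U"
  shows "\<exists>e'\<in>frames (twist_bundle \<rho> (O1 I) i) (reindex_line ` U). \<forall>p vs. length vs = i \<longrightarrow> e' p vs = pull e p vs"
  using assms(2)
proof (induction i arbitrary: e)
  case 0
  then show ?case by (simp add: structure_sheaf_def pull_def)
next
  case (Suc i)
  obtain e1 l where e: "e = tensor_section i e1 (\<lambda>p vs. l (hd vs))"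
    and e1: "e1 \<in> frames (twist_bundle \<sigma> (O1 I) i) U" and l: "homog_poly I 1 l"
    and nz: "\<forall>p\<in>(\<sigma> ^^ i) ` U. \<forall>v\<in>p - {\<lambda>_. 0}. l v \<noteq> 0"
    using Suc.prems unfolding frames_twist_O1_Suc by blast
  obtain e1' where e1': "e1' \<in> frames (twist_bundle \<rho> (O1 I) i) (reindex_line ` U)"
    and eq: "\<And>p vs. length vs = i \<Longrightarrow> e1' p vs = pull e1 p vs"
    using Suc.IH[OF e1] by blast
  let ?e = "tensor_section i e1' (\<lambda>p vs. l (reindex (hd vs)))"
  have "\<forall>p\<in>(\<rho> ^^ i) ` reindex_line ` U. \<forall>v\<in>p - {\<lambda>_. 0}. l (reindex v) \<noteq> 0"
  proof (intro ballI)
    fix p v assume "p \<in> (\<rho> ^^ i) ` reindex_line ` U" and v: "v \<in> p - {\<lambda>_. 0}"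
    then obtain q where q: "q \<in> U" "p = (\<rho> ^^ i) (reindex_line q)"
      by blast
    then have "reindex_line p = (\<sigma> ^^ i) q"
      using conj_funpow[of "reindex_line q" i] assms(1) by (simp add: subset_iff)
    moreover have "reindex v \<in> reindex_line p - {\<lambda>_. 0}"
      using v by simp
    ultimately show "l (reindex v) \<noteq> 0"
      using nz q(1) by blast
  qed
  then have "?e \<in> frames (twist_bundle \<rho> (O1 I) (Suc i)) (reindex_line ` U)"
    unfolding frames_twist_O1_Suc using e1' homog_poly_reindex[OF l]
    by (intro CollectI exI[of _ e1'] exI[of _ "\<lambda>v. l (reindex v)"]) simp
  moreover have "?e p vs = pull e p vs" if "length vs = Suc i" for p vs
  proof -
    have "drop i vs \<noteq> []"
      using that by simp
    then have "hd (drop i (map reindex vs)) = reindex (hd (drop i vs))"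
      by (simp add: drop_map hd_map)
    then show ?thesis
      using that by (simp add: tensor_section_def e eq pull_def take_map)
  qed
  ultimately show ?case
    by blast
qed

lemma pull_H0:
  assumes "s \<in> H0 I X (twist_bundle \<sigma> (O1 I) i)"
  shows "pull s \<in> H0 I X (twist_bundle \<rho> (O1 I) i)"
  unfolding H0_def
proof (intro CollectI conjI allI impI ballI)
  fix p vs assume "p \<notin> X \<or> vs \<notin> args (twist_bundle \<rho> (O1 I) i) p"
  then have "reindex_line p \<notin> X \<or> map reindex vs \<notin> args (twist_bundle \<sigma> (O1 I) i) (reindex_line p)"
    using map_reindex_args by auto
  then show "pull s p vs = 0"
    using assms unfolding H0_def pull_def by blast
next
  fix p assume "p \<in> X"
  then have "reindex_line p \<in> X"
    by simp
  then obtain U f e where U: "zariski_open I X U" "reindex_line p \<in> U" and f: "regular_on I X U f"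
    and e: "e \<in> frames (twist_bundle \<sigma> (O1 I) i) U"
    and s: "\<forall>q\<in>U. \<forall>vs\<in>args (twist_bundle \<sigma> (O1 I) i) q. s q vs = f q * e q vs"
    using assms unfolding H0_def by blast
  have UX: "U \<subseteq> X"
    using U(1) unfolding zariski_open_def by blast
  obtain e' where e': "e' \<in> frames (twist_bundle \<rho> (O1 I) i) (reindex_line ` U)"
    and eq: "\<And>p vs. length vs = i \<Longrightarrow> e' p vs = pull e p vs"
    using frames_reindex_line[OF UX e] by blast
  have "pull s q vs = f (reindex_line q) * e' q vs"
    if q: "q \<in> reindex_line ` U" and vs: "vs \<in> args (twist_bundle \<rho> (O1 I) i) q" for q vs
  proof -
    have "reindex_line q \<in> U" "q \<in> X"
      using q UX by auto
    then show ?thesis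
      using s vs map_reindex_args[of q vs i] eq[OF length_args_twist_O1[OF vs]] by (simp add: pull_def)
  qed
  then show "\<exists>U f e. zariski_open I X U \<and> p \<in> U \<and> regular_on I X U f \<and>
      e \<in> frames (twist_bundle \<rho> (O1 I) i) U \<and>
      (\<forall>q\<in>U. \<forall>vs\<in>args (twist_bundle \<rho> (O1 I) i) q. pull s q vs = f q * e q vs)"
    using zariski_open_reindex_line[OF U(1)] regular_on_reindex_line[OF f] e' U(2)
    by (intro exI[of _ "reindex_line ` U"] exI[of _ "\<lambda>p. f (reindex_line p)"] exI[of _ e']) simp
qed

lemma pull_graded_carrier:
  assumes "x \<in> carrier (twisted_ring I X \<sigma> (O1 I))"
  shows "pull_graded x \<in> carrier (twisted_ring I X \<rho> (O1 I))"
  using assms pull_H0 by (simp add: twisted_ring_def pull_graded_def)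

text \<open>The left factors agree on the nose; for the right factors the claim is that nu' after
  \<open>\<rho> ^^ i\<close> equals \<open>\<sigma> ^^ i\<close> after nu'.\<close>

lemma pull_graded_mult:
  assumes "x \<in> carrier (twisted_ring I X \<sigma> (O1 I))"
  shows "pull_graded (x \<otimes>\<^bsub>twisted_ring I X \<sigma> (O1 I)\<^esub> y) = pull_graded x \<otimes>\<^bsub>twisted_ring I X \<rho> (O1 I)\<^esub> pull_graded y"
proof (intro ext)
  fix m p vs
  have "pull (twist_mult \<sigma> (O1 I) i (x i) (y (m - i))) p vs =
      twist_mult \<rho> (O1 I) i (pull (x i)) (pull (y (m - i))) p vs" for i
  proof (cases "p \<in> X")
    case True
    then show ?thesis
      by (simp add: twist_mult_def tensor_section_def pullback_section_def pull_def arity_twist_O1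
          take_map drop_map conj_funpow)
  next
    case False
    \<comment> \<open>The conjugation relation is available only on \<open>X\<close>. Elsewhere both
      products vanish through their left factor, as nu' also preserves the complement of
      \<open>X\<close>.\<close>
    have "x i \<in> H0 I X (twist_bundle \<sigma> (O1 I) i)"
      using assms by (simp add: twisted_ring_def)
    then have "x i (reindex_line p) ws = 0" for ws
      using False unfolding H0_def by (metis (mono_tags, lifting) mem_Collect_eq reindex_line_variety)
    then show ?thesis
      by (simp add: twist_mult_def tensor_section_def pull_def)
  qed
  then show "pull_graded (x \<otimes>\<^bsub>twisted_ring I X \<sigma> (O1 I)\<^esub> y) m p vs =
      (pull_graded x \<otimes>\<^bsub>twisted_ring I X \<rho> (O1 I)\<^esub> pull_graded y) m p vs"
    by (simp add: twisted_ring_def pull_graded_def pull_def)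
qed

lemma pull_graded_homogeneous_part:
  assumes "x \<in> homogeneous_part (twisted_ring I X \<sigma> (O1 I)) i"
  shows "pull_graded x \<in> homogeneous_part (twisted_ring I X \<rho> (O1 I)) i"
proof -
  have "\<zero>\<^bsub>twisted_ring I X \<sigma> (O1 I)\<^esub> = (\<lambda>i p vs. 0)" "\<zero>\<^bsub>twisted_ring I X \<rho> (O1 I)\<^esub> = (\<lambda>i p vs. 0)"
    by (simp_all add: twisted_ring_def)
  then show ?thesis
    using assms pull_graded_carrier[of x] by (simp add: homogeneous_part_def) (simp add: pull_graded_def)
qed

theorem twisted_ring_iso:
  "graded_algebra_iso (twisted_ring I X \<sigma> (O1 I)) (twisted_ring I X \<rho> (O1 I)) pull_graded"
proof -
  \<comment> \<open>Read in the opposite direction, \<open>pull_graded\<close> is its own inverse;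
    this gives bijectivity and surjectivity in each degree.\<close>
  interpret sym: conjugating_involution I X \<beta> \<rho> \<sigma>
    by (rule conjugating_involution_sym)
  let ?A = "twisted_ring I X \<sigma> (O1 I)" and ?B = "twisted_ring I X \<rho> (O1 I)"
  have "pull_graded \<in> ring_hom ?A ?B"
  proof (rule ring_hom_memI)
    show "pull_graded (x \<oplus>\<^bsub>?A\<^esub> y) = pull_graded x \<oplus>\<^bsub>?B\<^esub> pull_graded y" for x y
      by (simp add: twisted_ring_def pull_graded_def pull_def)
    show "pull_graded \<one>\<^bsub>?A\<^esub> = \<one>\<^bsub>?B\<^esub>"
      by (simp add: twisted_ring_def pull_graded_def pull_def)
  qed (simp_all add: pull_graded_carrier pull_graded_mult)
  moreover have "bij_betw pull_graded (carrier ?A) (carrier ?B)"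
    by (rule bij_betw_byWitness[where f' = pull_graded]) (auto simp: pull_graded_carrier sym.pull_graded_carrier)
  moreover have "pull_graded ` homogeneous_part ?A i = homogeneous_part ?B i" for i
  proof
    show "homogeneous_part ?B i \<subseteq> pull_graded ` homogeneous_part ?A i"
      using sym.pull_graded_homogeneous_part by (metis pull_graded_pull_graded imageI subsetI)
  qed (use pull_graded_homogeneous_part in blast)
  moreover have "pull_graded (c \<odot>\<^bsub>?A\<^esub> x) = c \<odot>\<^bsub>?B\<^esub> pull_graded x" for c x
    by (simp add: twisted_ring_def pull_graded_def pull_def)
  ultimately show ?thesis
    by (simp add: graded_algebra_iso_def ring_iso_def)
qed

end


section \<open>The involution of the sections induced by negation\<close>

text \<open>Acting on all functions, not only on sections, makes it an involution of the whole
  coordinate type, as \<open>invol\<close> demands.\<close>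

definition reflect :: "(complex vec \<Rightarrow> complex) \<Rightarrow> complex vec \<Rightarrow> complex" where
  "reflect f = (\<lambda>z. f (- z))"

lemma reflect_reflect [simp]: "reflect (reflect f) = f"
  by (simp add: reflect_def)

lemma uminus_mem_polydisc:
  assumes "a \<in> carrier_vec g"
  shows "- z \<in> polydisc g (- a) r \<longleftrightarrow> z \<in> polydisc g a r"
proof -
  have "cmod ((- z) $ i - (- a) $ i) = cmod (z $ i - a $ i)" if "i < g" "z \<in> carrier_vec g" for i
    using that assms by (simp add: norm_minus_commute)
  then show ?thesis
    by (auto simp: polydisc_def)
qed

lemma holomorphic_near_reflect:
  assumes "a \<in> carrier_vec g" and "holomorphic_near g (- a) F"
  shows "holomorphic_near g a (\<lambda>z. s * F (- z))"
proof -
  obtain r c where r: "r > 0" and sum: "\<And>z. z \<in> polydisc g (- a) r \<Longrightarrow>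
      ((\<lambda>\<alpha>. c \<alpha> * (\<Prod>i<g. (z $ i - (- a) $ i) ^ (\<alpha> $ i))) has_sum F z) (carrier_vec g)"
    using assms(2) unfolding holomorphic_near_def by blast
  \<comment> \<open>Substituting \<open>- z\<close> multiplies the monomial of index
    \<open>\<alpha>\<close> by -1 to its total degree; \<open>s\<close> leaves room for the sign of
    the local equation.\<close>
  let ?c = "\<lambda>\<alpha> :: nat vec. s * (c \<alpha> * (\<Prod>i<g. (- 1) ^ (\<alpha> $ i)))"
  have "((\<lambda>\<alpha>. ?c \<alpha> * (\<Prod>i<g. (z $ i - a $ i) ^ (\<alpha> $ i))) has_sum s * F (- z)) (carrier_vec g)"
    if z: "z \<in> polydisc g a r" for z
  proof -
    have zc: "z \<in> carrier_vec g"
      using z by (simp add: polydisc_def)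
    have "(\<Prod>i<g. ((- z) $ i - (- a) $ i) ^ (\<alpha> $ i)) =
        (\<Prod>i<g. (- 1) ^ (\<alpha> $ i)) * (\<Prod>i<g. (z $ i - a $ i) ^ (\<alpha> $ i))" for \<alpha> :: "nat vec"
      unfolding prod.distrib[symmetric] power_mult_distrib[symmetric]
      using zc assms(1) by (intro prod.cong) auto
    then show ?thesis
      using has_sum_cmult_right[OF sum[of "- z"], of s] z assms(1)
      by (simp add: uminus_mem_polydisc mult.assoc)
  qed
  then show ?thesis
    unfolding holomorphic_near_def using r by (intro exI[of _ r] conjI exI[of _ ?c]) simp_all
qed

lemma complex_lattice_uminus:
  assumes "complex_lattice \<Lambda>"
  shows "- x \<in> \<Lambda> \<longleftrightarrow> x \<in> \<Lambda>"
proof -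
  obtain w1 w2 where L: "\<Lambda> = {of_int a * w1 + of_int b * w2 | a b. True}"
    using assms unfolding complex_lattice_def by blast
  have "- y \<in> \<Lambda>" if y: "y \<in> \<Lambda>" for y
  proof -
    obtain a b where "y = of_int a * w1 + of_int b * w2"
      using y L by blast
    then have "- y = of_int (- a) * w1 + of_int (- b) * w2"
      by simp
    then show ?thesis
      using L by blast
  qed
  from this[of x] this[of "- x"] show ?thesis
    by auto
qed

text \<open>This is -1 to the multiplicity of the divisor at \<open>a\<close>: each component
  through \<open>a\<close> has a linear equation, which changes sign under negation.\<close>

definition local_sign :: "complex set \<Rightarrow> nat list \<Rightarrow> complex vec \<Rightarrow> complex" where
  "local_sign \<Lambda> ns a =
     (\<Prod>i<length ns. if a $ i \<in> \<Lambda> then (- 1) ^ div_mult ns i else 1) *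
     (\<Prod>j<length ns - 1. if a $ j - a $ Suc j \<in> \<Lambda> then - 1 else 1)"

lemma local_sign_neq_0: "local_sign \<Lambda> ns a \<noteq> 0"
  by (simp add: local_sign_def)

lemma local_eqn_uminus:
  assumes "complex_lattice \<Lambda>" and "a \<in> carrier_vec (length ns)" and "z \<in> carrier_vec (length ns)"
  shows "local_eqn \<Lambda> ns (- a) (- z) = local_sign \<Lambda> ns a * local_eqn \<Lambda> ns a z"
proof -
  have "(\<Prod>i<length ns. if (- a) $ i \<in> \<Lambda> then ((- z) $ i - (- a) $ i) ^ div_mult ns i else 1) =
      (\<Prod>i<length ns. (if a $ i \<in> \<Lambda> then (- 1) ^ div_mult ns i else 1) *
         (if a $ i \<in> \<Lambda> then (z $ i - a $ i) ^ div_mult ns i else 1))"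
    using assms by (intro prod.cong)
      (auto simp: complex_lattice_uminus simp flip: power_mult_distrib)
  moreover have "(\<Prod>j<length ns - 1. if (- a) $ j - (- a) $ Suc j \<in> \<Lambda>
        then ((- z) $ j - (- z) $ Suc j) - ((- a) $ j - (- a) $ Suc j) else 1) =
      (\<Prod>j<length ns - 1. (if a $ j - a $ Suc j \<in> \<Lambda> then - 1 else 1) *
         (if a $ j - a $ Suc j \<in> \<Lambda> then (z $ j - z $ Suc j) - (a $ j - a $ Suc j) else 1))"
  proof (intro prod.cong refl)
    fix j assume "j \<in> {..<length ns - 1}"
    then have "j < length ns" "Suc j < length ns"
      by auto
    moreover have "- (a $ j) + a $ Suc j \<in> \<Lambda> \<longleftrightarrow> a $ j - a $ Suc j \<in> \<Lambda>"
      using complex_lattice_uminus[OF assms(1), of "a $ j - a $ Suc j"] by simp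
    ultimately show "(if (- a) $ j - (- a) $ Suc j \<in> \<Lambda>
        then ((- z) $ j - (- z) $ Suc j) - ((- a) $ j - (- a) $ Suc j) else 1) =
      (if a $ j - a $ Suc j \<in> \<Lambda> then - 1 else 1) *
         (if a $ j - a $ Suc j \<in> \<Lambda> then (z $ j - z $ Suc j) - (a $ j - a $ Suc j) else 1)"
      using assms by simp
  qed
  ultimately show ?thesis
    unfolding local_eqn_def local_sign_def prod.distrib by (simp add: mult_ac)
qed

lemma div_supp_uminus:
  assumes "complex_lattice \<Lambda>"
  shows "- a \<in> div_supp \<Lambda> ns \<longleftrightarrow> a \<in> div_supp \<Lambda> ns"
  using local_eqn_uminus[OF assms, of a ns a] by (auto simp: div_supp_def local_sign_neq_0)

text \<open>Negation turns the local equation at \<open>- a\<close> into \<open>local_sign\<close>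
  times the one at \<open>a\<close>, so this sign has to be divided out.\<close>

lemma local_section_reflect:
  assumes L: "complex_lattice \<Lambda>" and a: "a \<in> carrier_vec (length ns)"
    and F: "local_section \<Lambda> ns (- a) f F"
  shows "local_section \<Lambda> ns a (reflect f) (\<lambda>z. inverse (local_sign \<Lambda> ns a) * F (- z))"
proof -
  obtain r where r: "r > 0"
    and eq: "\<And>z. z \<in> polydisc (length ns) (- a) r - div_supp \<Lambda> ns \<Longrightarrow> f z * local_eqn \<Lambda> ns (- a) z = F z"
    using F unfolding local_section_def by blast
  have "f (- z) * local_eqn \<Lambda> ns a z = inverse (local_sign \<Lambda> ns a) * F (- z)"
    if z: "z \<in> polydisc (length ns) a r - div_supp \<Lambda> ns" for z
  proof -
    have "z \<in> carrier_vec (length ns)"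
      using z by (simp add: polydisc_def)
    then have "F (- z) = local_sign \<Lambda> ns a * (f (- z) * local_eqn \<Lambda> ns a z)"
      using eq[of "- z"] z L a by (simp add: uminus_mem_polydisc div_supp_uminus local_eqn_uminus mult_ac)
    then show ?thesis
      by (simp add: local_sign_neq_0)
  qed
  then show ?thesis
    unfolding local_section_def reflect_def
    using r holomorphic_near_reflect[OF a] F[unfolded local_section_def] by blast
qed

lemma reflect_H0_E:
  assumes L: "complex_lattice \<Lambda>" and f: "f \<in> H0_E \<Lambda> ns"
  shows "reflect f \<in> H0_E \<Lambda> ns"
  unfolding H0_E_def
proof (intro CollectI conjI allI ballI impI)
  fix z assume "z \<notin> carrier_vec (length ns) \<or> z \<in> div_supp \<Lambda> ns"
  then have "- z \<notin> carrier_vec (length ns) \<or> - z \<in> div_supp \<Lambda> ns"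
    using L by (simp add: div_supp_uminus)
  then show "reflect f z = 0"
    using f unfolding H0_E_def reflect_def by blast
next
  fix z l :: "complex vec"
  assume z: "z \<in> carrier_vec (length ns)" and l: "l \<in> carrier_vec (length ns)"
    and per: "\<forall>i<length ns. l $ i \<in> \<Lambda>"
  have "- (z + l) = - z + - l"
    using z l by auto
  moreover have "\<forall>i<length ns. (- l) $ i \<in> \<Lambda>"
    using per l L by (simp add: complex_lattice_uminus)
  moreover have "- z \<in> carrier_vec (length ns)" "- l \<in> carrier_vec (length ns)"
    using z l by simp_all
  ultimately show "reflect f (z + l) = reflect f z"
    using f unfolding H0_E_def reflect_def by simp
next
  fix a :: "complex vec" assume a: "a \<in> carrier_vec (length ns)"
  then have "- a \<in> carrier_vec (length ns)"
    by simp
  then obtain F where "local_section \<Lambda> ns (- a) f F"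
    using f unfolding H0_E_def by blast
  then show "\<exists>F. local_section \<Lambda> ns a (reflect f) F"
    using local_section_reflect[OF L a] by blast
qed


section \<open>Evaluation of sections is well defined\<close>

text \<open>The slopes are nonzero and consecutive ones differ, so no component of the divisor contains
  the ray.\<close>

definition ray :: "nat \<Rightarrow> complex vec \<Rightarrow> real \<Rightarrow> complex vec" where
  "ray g a t = vec g (\<lambda>i. a $ i + of_real t * of_nat (Suc i))"

lemma ray_polydisc:
  assumes "\<bar>t\<bar> * real g < r" and "r > 0"
  shows "ray g a t \<in> polydisc g a r"
proof -
  have "\<bar>t\<bar> * real (Suc i) < r" if "i < g" for i
  proof -
    have "\<bar>t\<bar> * real (Suc i) \<le> \<bar>t\<bar> * real g"
      using that by (intro mult_left_mono) auto
    then show ?thesis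
      using assms(1) by linarith
  qed
  then show ?thesis
    by (auto simp: polydisc_def ray_def norm_mult simp del: of_nat_Suc)
qed

text \<open>On the ray, the term of the power series with multiindex \<open>\<alpha> \<noteq> 0\<close> at \<open>t\<close> is at most
  \<open>t / t0\<close> times its value at \<open>t0\<close>.\<close>

lemma holomorphic_near_ray:
  assumes a: "a \<in> carrier_vec g" and F: "holomorphic_near g a F"
  shows "((\<lambda>t. F (ray g a t)) \<longlongrightarrow> F a) (at_right 0)"
proof -
  obtain r c where r: "r > 0" and sum: "\<And>z. z \<in> polydisc g a r \<Longrightarrow>
      ((\<lambda>\<alpha>. c \<alpha> * (\<Prod>i<g. (z $ i - a $ i) ^ (\<alpha> $ i))) has_sum F z) (carrier_vec g)"
    using F unfolding holomorphic_near_def by blast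
  \<comment> \<open>All slopes are at most \<open>g\<close>, so the ray stays in the polydisc up to
    \<open>t0\<close>; \<open>Suc g\<close> keeps the denominator positive for
    \<open>g = 0\<close>.\<close>
  define t0 where "t0 = r / (2 * real (Suc g))"
  define T where "T t \<alpha> = c \<alpha> * (\<Prod>i<g. (of_real t * of_nat (Suc i)) ^ (\<alpha> $ i))" for t and \<alpha> :: "nat vec"
  have t0: "t0 > 0"
    using r by (simp add: t0_def)
  have t0g: "t0 * real g < r"
    using r by (simp add: t0_def field_simps) (smt (verit) mult_nonneg_nonneg of_nat_0_le_iff)
  have ray0: "ray g a 0 = a"
    using a by (auto simp: ray_def)
  have sumT: "(T t has_sum F (ray g a t)) (carrier_vec g)" if "0 \<le> t" "t \<le> t0" for t
  proof -
    have "\<bar>t\<bar> * real g \<le> t0 * real g"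
      using that by (intro mult_right_mono) auto
    then have "ray g a t \<in> polydisc g a r"
      using t0g r by (intro ray_polydisc) auto
    from sum[OF this] show ?thesis
      by (rule has_sum_cong[THEN iffD1, rotated]) (auto simp: T_def ray_def)
  qed
  define K where "K = infsum (\<lambda>\<alpha>. norm (T t0 \<alpha>)) (carrier_vec g)"
  \<comment> \<open>For complex families unconditional summability is absolute summability, so
    \<open>K\<close> is a genuine sum of norms.\<close>
  have abs: "(\<lambda>\<alpha>. norm (T t0 \<alpha>)) summable_on carrier_vec g"
    using has_sum_imp_summable[OF sumT[of t0]] t0
    by (simp add: summable_on_iff_abs_summable_on_complex)
  \<comment> \<open>Terms are homogeneous in \<open>t\<close>. At \<open>t = 0\<close> only total
    degree zero survives, by \<open>0 ^ 0 = 1\<close>, and that term is the same for every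
    \<open>t\<close>.\<close>
  have scale: "T t \<alpha> = of_real (t / t0) ^ (\<Sum>i<g. \<alpha> $ i) * T t0 \<alpha>" for t \<alpha>
  proof -
    have "(\<Prod>i<g. (of_real t * of_nat (Suc i)) ^ (\<alpha> $ i)) =
        (\<Prod>i<g. (of_real (t / t0) :: complex) ^ (\<alpha> $ i) * (of_real t0 * of_nat (Suc i)) ^ (\<alpha> $ i))"
      unfolding power_mult_distrib[symmetric] using t0 by (intro prod.cong) auto
    then show ?thesis
      by (simp only: T_def prod.distrib power_sum mult_ac)
  qed
  have bound: "norm (F (ray g a t) - F a) \<le> t / t0 * K" if t: "0 \<le> t" "t \<le> t0" for t
  proof -
    have diff: "((\<lambda>\<alpha>. T t \<alpha> - T 0 \<alpha>) has_sum (F (ray g a t) - F a)) (carrier_vec g)"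
      using has_sum_add[OF sumT[OF t] has_sum_uminusI[OF sumT[of 0]]] t0
      by (simp add: ray0)
    have le: "norm (T t \<alpha> - T 0 \<alpha>) \<le> t / t0 * norm (T t0 \<alpha>)" for \<alpha>
    proof (cases "(\<Sum>i<g. \<alpha> $ i) = 0")
      case True
      then have "T t \<alpha> = T 0 \<alpha>"
        using scale[of t \<alpha>] scale[of 0 \<alpha>] by (simp only: power_0)
      then show ?thesis
        using t t0 by simp
    next
      case False
      then have "T t \<alpha> - T 0 \<alpha> = of_real (t / t0) ^ (\<Sum>i<g. \<alpha> $ i) * T t0 \<alpha>"
        using scale[of t \<alpha>] scale[of 0 \<alpha>] by (simp del: sum_eq_0_iff)
      then have "norm (T t \<alpha> - T 0 \<alpha>) = (t / t0) ^ (\<Sum>i<g. \<alpha> $ i) * norm (T t0 \<alpha>)"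
        using t t0 by (simp only: norm_mult norm_power norm_of_real) simp
      moreover have "1 \<le> (\<Sum>i<g. \<alpha> $ i)"
        using False by linarith
      then have "(t / t0) ^ (\<Sum>i<g. \<alpha> $ i) \<le> (t / t0) ^ 1"
        using t t0 by (intro power_decreasing) auto
      ultimately show ?thesis
        by (metis mult_right_mono norm_ge_zero power_one_right)
    qed
    have "((\<lambda>\<alpha>. t / t0 * norm (T t0 \<alpha>)) has_sum (t / t0 * K)) (carrier_vec g)"
      unfolding K_def using abs by (intro has_sum_cmult_right) simp
    then show ?thesis
      by (rule norm_infsum_le[OF diff]) (use le in auto)
  qed
  have "((\<lambda>t. t / t0 * K) \<longlongrightarrow> 0 / t0 * K) (at_right 0)"
    using t0 by (intro tendsto_intros) auto
  then have lim: "((\<lambda>t. t / t0 * K) \<longlongrightarrow> 0) (at_right 0)"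
    by simp
  have "norm (F (ray g a t) - F a) \<le> norm (t / t0 * K) * 1" if "t \<in> {0<..<t0}" for t
    using order_trans[OF bound[of t] abs_ge_self] that by simp
  then have "eventually (\<lambda>t. norm (F (ray g a t) - F a) \<le> norm (t / t0 * K) * 1) (at_right 0)"
    by (rule eventually_at_rightI[OF _ t0])
  then have "((\<lambda>t. F (ray g a t) - F a) \<longlongrightarrow> 0) (at_right 0)"
    by (rule tendsto_0_le[OF lim])
  then show ?thesis
    using LIM_zero_iff by blast
qed

lemma countable_complex_lattice:
  assumes "complex_lattice \<Lambda>"
  shows "countable \<Lambda>"
proof -
  obtain w1 w2 where "\<Lambda> = {of_int a * w1 + of_int b * w2 | a b. True}"
    using assms unfolding complex_lattice_def by blast
  then have "\<Lambda> = (\<lambda>(a, b). of_int a * w1 + of_int b * w2) ` UNIV"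
    by auto
  then show ?thesis
    by simp
qed

lemma div_suppD:
  assumes "a \<in> div_supp \<Lambda> ns"
  shows "(\<exists>i<length ns. a $ i \<in> \<Lambda>) \<or> (\<exists>j<length ns - 1. a $ j - a $ Suc j \<in> \<Lambda>)"
  using assms by (auto simp: div_supp_def local_eqn_def split: if_splits)

text \<open>On the divisor some coordinate or consecutive difference lies in the countable lattice,
  and along the ray each of these is an injective affine function of \<open>t\<close>.\<close>

lemma countable_ray_div_supp:
  assumes "complex_lattice \<Lambda>"
  shows "countable {t. ray (length ns) a t \<in> div_supp \<Lambda> ns}"
proof -
  have vimage: "countable (h -` \<Lambda>)" if "inj h" for h :: "real \<Rightarrow> complex"
    using countable_image_inj_on[of h "h -` \<Lambda>"] that countable_complex_lattice[OF assms]
    by (meson countable_subset image_vimage_subset inj_on_subset subset_UNIV)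
  have 1: "countable ((\<lambda>t. a $ i + of_real t * of_nat (Suc i)) -` \<Lambda>)" for i
    by (rule vimage, rule injI) (simp del: of_nat_Suc)
  have 2: "countable ((\<lambda>t. (a $ i - a $ Suc i) - of_real t) -` \<Lambda>)" for i
    by (rule vimage, rule injI) simp
  \<comment> \<open>The unions may run over all indices: an entry out of range is just some
    constant, which leaves the affine maps injective.\<close>
  have "{t. ray (length ns) a t \<in> div_supp \<Lambda> ns} \<subseteq>
      (\<Union>i. (\<lambda>t. a $ i + of_real t * of_nat (Suc i)) -` \<Lambda>) \<union>
      (\<Union>i. (\<lambda>t. (a $ i - a $ Suc i) - of_real t) -` \<Lambda>)"
  proof
    fix t assume "t \<in> {t. ray (length ns) a t \<in> div_supp \<Lambda> ns}"
    then consider i where "i < length ns" "ray (length ns) a t $ i \<in> \<Lambda>"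
      | j where "j < length ns - 1" "ray (length ns) a t $ j - ray (length ns) a t $ Suc j \<in> \<Lambda>"
      using div_suppD by blast
    then show "t \<in> (\<Union>i. (\<lambda>t. a $ i + of_real t * of_nat (Suc i)) -` \<Lambda>) \<union>
        (\<Union>i. (\<lambda>t. (a $ i - a $ Suc i) - of_real t) -` \<Lambda>)"
    proof cases
      case 1
      then show ?thesis by (auto simp: ray_def)
    next
      case (2 j)
      have "ray (length ns) a t $ j - ray (length ns) a t $ Suc j = (a $ j - a $ Suc j) - of_real t"
        using 2(1) by (simp add: ray_def algebra_simps)
      then show ?thesis
        using 2(2) by auto
    qed
  qed
  then show ?thesis
    by (rule countable_subset) (use 1 2 in auto)
qed

text \<open>If the values at \<open>a\<close> differed, then by continuity \<open>F\<close> and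
  \<open>G\<close> would differ for all small \<open>t > 0\<close> on the ray. These form an
  uncountable interval, so some such point is off the divisor, where both equal \<open>f\<close>
  times the local equation.\<close>

lemma local_section_unique:
  assumes L: "complex_lattice \<Lambda>" and a: "a \<in> carrier_vec (length ns)"
    and F: "local_section \<Lambda> ns a f F" and G: "local_section \<Lambda> ns a f G"
  shows "F a = G a"
proof (rule ccontr)
  assume "F a \<noteq> G a"
  let ?g = "length ns"
  have "((\<lambda>t. F (ray ?g a t) - G (ray ?g a t)) \<longlongrightarrow> F a - G a) (at_right 0)"
    using F G a unfolding local_section_def by (intro tendsto_diff holomorphic_near_ray) auto
  then have "eventually (\<lambda>t. F (ray ?g a t) - G (ray ?g a t) \<noteq> 0) (at_right 0)"
    using \<open>F a \<noteq> G a\<close> by (intro tendsto_imp_eventually_ne) auto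
  then obtain b where b: "b > 0" and ne: "\<And>t. 0 < t \<Longrightarrow> t < b \<Longrightarrow> F (ray ?g a t) \<noteq> G (ray ?g a t)"
    unfolding eventually_at_right_field by auto
  obtain r where r: "r > 0" and eqF: "\<forall>z\<in>polydisc ?g a r - div_supp \<Lambda> ns. f z * local_eqn \<Lambda> ns a z = F z"
    using F unfolding local_section_def by blast
  obtain s where s: "s > 0" and eqG: "\<forall>z\<in>polydisc ?g a s - div_supp \<Lambda> ns. f z * local_eqn \<Lambda> ns a z = G z"
    using G unfolding local_section_def by blast
  \<comment> \<open>Below \<open>b\<close> the two extensions differ; the other bound keeps the ray
    in both polydiscs.\<close>
  define d where "d = min b (min r s / real (Suc ?g))"
  have "d > 0"
    using b r s by (simp add: d_def)
  then have "uncountable {0<..<d}"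
    by (simp add: uncountable_open_interval)
  then obtain t where t: "t \<in> {0<..<d}" and off: "ray ?g a t \<notin> div_supp \<Lambda> ns"
    using countable_subset[OF _ countable_ray_div_supp[OF L, of ns a]] by blast
  have "t < min r s / real (Suc ?g)"
    using t by (simp add: d_def)
  then have "t * real (Suc ?g) < min r s"
    by (simp only: pos_less_divide_eq of_nat_0_less_iff zero_less_Suc)
  then have "t * real ?g < min r s"
    using t by (simp add: algebra_simps)
  then have "ray ?g a t \<in> polydisc ?g a r" "ray ?g a t \<in> polydisc ?g a s"
    using t r s by (auto intro!: ray_polydisc)
  then have "F (ray ?g a t) = G (ray ?g a t)"
    using eqF eqG off by (metis DiffI)
  then show False
    using ne[of t] t by (simp add: d_def)
qed

text \<open>By uniqueness, any local extension may be used to compute the definite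
  description.\<close>

lemma eval_section_eq:
  assumes "complex_lattice \<Lambda>" and "a \<in> carrier_vec (length ns)" and "f \<in> H0_E \<Lambda> ns"
    and "local_section \<Lambda> ns a f F"
  shows "eval_section \<Lambda> ns a f = F a"
  unfolding eval_section_def using assms local_section_unique by (auto intro!: the_equality)


section \<open>The involution of the characteristic variety\<close>

lemma eval_section_uminus:
  assumes L: "complex_lattice \<Lambda>" and a: "a \<in> carrier_vec (length ns)"
  shows "eval_section \<Lambda> ns a (reflect f) = inverse (local_sign \<Lambda> ns a) * eval_section \<Lambda> ns (- a) f"
proof (cases "f \<in> H0_E \<Lambda> ns")
  case True
  have a': "- a \<in> carrier_vec (length ns)"
    using a by simp
  then obtain F where F: "local_section \<Lambda> ns (- a) f F"
    using True unfolding H0_E_def by blast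
  show ?thesis
    using eval_section_eq[OF L a reflect_H0_E[OF L True] local_section_reflect[OF L a F]]
      eval_section_eq[OF L a' True F] by simp
next
  case False
  \<comment> \<open>Functionals are zero outside \<open>H0_E\<close>, whose complement is also
    stable because \<open>reflect\<close> is an involution.\<close>
  then have "reflect f \<notin> H0_E \<Lambda> ns"
    using reflect_H0_E[OF L, of "reflect f"] by auto
  with False show ?thesis
    by (simp add: eval_section_def)
qed

text \<open>The sign is nonzero and is absorbed by the free scalar of the line, so reindexing
  coordinates realizes nu' on the image of \<open>Phi\<close>.\<close>

lemma Phi_uminus:
  assumes "complex_lattice \<Lambda>" and "a \<in> carrier_vec (length ns)"
  shows "(\<lambda>v. v \<circ> reflect) ` Phi \<Lambda> ns a = Phi \<Lambda> ns (- a)"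
proof -
  let ?s = "local_sign \<Lambda> ns a" and ?e = "eval_section \<Lambda> ns (- a)"
  have "Phi \<Lambda> ns a = range (\<lambda>c f. c * eval_section \<Lambda> ns a f)"
    by (auto simp: Phi_def)
  then have "(\<lambda>v. v \<circ> reflect) ` Phi \<Lambda> ns a = range (\<lambda>c f. c * inverse ?s * ?e f)"
    by (simp add: image_image comp_def eval_section_uminus[OF assms] mult.assoc)
  also have "\<dots> = Phi \<Lambda> ns (- a)"
  proof
    show "Phi \<Lambda> ns (- a) \<subseteq> range (\<lambda>c f. c * inverse ?s * ?e f)"
    proof
      fix v assume "v \<in> Phi \<Lambda> ns (- a)"
      then obtain c where "v = (\<lambda>f. c * ?e f)"
        unfolding Phi_def by blast
      then have "v = (\<lambda>f. (c * ?s) * inverse ?s * ?e f)"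
        by (simp add: fun_eq_iff mult.assoc local_sign_neq_0)
      then show "v \<in> range (\<lambda>c f. c * inverse ?s * ?e f)"
        by blast
    qed
  qed (auto simp: Phi_def)
  finally show ?thesis .
qed


theorem theorem3p4:
  fixes n k :: nat and \<Lambda> :: "complex set" and \<tau> :: complex and ns :: "nat list"
    and \<sigma>' :: "functional set \<Rightarrow> functional set"
  assumes "1 \<le> k" and "k < n" and "coprime n k"
    and "complex_lattice \<Lambda>"
    and "ns \<noteq> []" and "\<forall>m\<in>set ns. 2 \<le> m" and "of_nat n / of_nat k = neg_cont_frac ns"
    and "variety_automorphism (H0_E \<Lambda> ns) (char_variety \<Lambda> ns) \<sigma>'"
    and "\<forall>z\<in>carrier_vec (length ns). Phi \<Lambda> ns (translation n ns \<tau> z) = \<sigma>' (Phi \<Lambda> ns z)"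
  shows "\<exists>h. graded_algebra_iso
    (twisted_ring (H0_E \<Lambda> ns) (char_variety \<Lambda> ns) \<sigma>' (O1 (H0_E \<Lambda> ns)))
    (twisted_ring (H0_E \<Lambda> ns) (char_variety \<Lambda> ns) (inv_into (char_variety \<Lambda> ns) \<sigma>') (O1 (H0_E \<Lambda> ns))) h"
proof -
  let ?I = "H0_E \<Lambda> ns" and ?X = "char_variety \<Lambda> ns" and ?g = "length ns"
  let ?\<rho> = "inv_into ?X \<sigma>'"
  note L = \<open>complex_lattice \<Lambda>\<close>
  have bij: "bij_betw \<sigma>' ?X ?X"
    using assms(8) unfolding variety_automorphism_def by blast
  interpret coordinate_involution ?I ?X reflect
  proof
    show "(\<lambda>v. v \<circ> reflect) ` p \<in> ?X" if p: "p \<in> ?X" for p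
    proof -
      obtain z where z: "z \<in> carrier_vec ?g" "p = Phi \<Lambda> ns z"
        using p unfolding char_variety_def by blast
      then have "- z \<in> carrier_vec ?g"
        by simp
      then show ?thesis
        using Phi_uminus[OF L z(1)] z(2) by (simp add: char_variety_def)
    qed
  qed (simp_all add: reflect_H0_E L)
  have reindex_line_Phi: "reindex_line (Phi \<Lambda> ns z) = Phi \<Lambda> ns (- z)" if "z \<in> carrier_vec ?g" for z
    using Phi_uminus[OF L that] by (simp add: reindex_line_def reindex_def[abs_def])
  \<comment> \<open>The conjugation relation in a form free of inverses: translating by
    \<open>v\<close>, negating and translating by \<open>v\<close> again takes \<open>z\<close> to
    \<open>- (z + v) + v = - z\<close>.\<close>
  have key: "\<sigma>' (reindex_line (\<sigma>' p)) = reindex_line p" if p: "p \<in> ?X" for p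
  proof -
    obtain z where z: "z \<in> carrier_vec ?g" "p = Phi \<Lambda> ns z"
      using p unfolding char_variety_def by blast
    let ?t = "translation n ns \<tau>"
    have tz: "?t z \<in> carrier_vec ?g"
      using z(1) by (auto simp: translation_def)
    have "\<sigma>' (reindex_line (\<sigma>' p)) = \<sigma>' (Phi \<Lambda> ns (- ?t z))"
      using assms(9) z reindex_line_Phi[OF tz] by simp
    also have "\<dots> = Phi \<Lambda> ns (?t (- ?t z))"
      using assms(9) tz by simp
    also have "?t (- ?t z) = - z"
      using z(1) by (auto simp: translation_def)
    finally show ?thesis
      using reindex_line_Phi[OF z(1)] z(2) by simp
  qed
  interpret conjugating_involution ?I ?X reflect \<sigma>' ?\<rho>
  proof
    show "\<sigma>' p \<in> ?X" if "p \<in> ?X" for p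
      using bij that by (rule bij_betw_apply)
    show \<rho>: "?\<rho> p \<in> ?X" if "p \<in> ?X" for p
      using bij_betw_inv_into[OF bij] that by (rule bij_betw_apply)
    \<comment> \<open>Apply \<open>key\<close> at \<open>?\<rho> p\<close>, where the inner
      \<open>\<sigma>'\<close> cancels.\<close>
    show "reindex_line (?\<rho> p) = \<sigma>' (reindex_line p)" if "p \<in> ?X" for p
      using key[OF \<rho>[OF that]] bij_betw_inv_into_right[OF bij that] by simp
  qed
  show ?thesis
    using twisted_ring_iso by blast
qed

end
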